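(* Let $k\ge 2$ be even and let $G$ be an odd-bipartite, connected $k$-uniform hypergraph with $m\ge 1$ edges. Let $c_{\max}$ be the largest component among all least eigenvectors of $G$. Then $$c_{\max}\ge \sqrt[k]{-\frac{\lambda(G)}{km}},$$ with equality if and only if $G$ is regular.
   Context: A $k$-uniform hypergraph $G$ has vertex set $V(G)$ and edge set $E(G)$ consisting of $k$-element subsets of $V(G)$. For even $k$, $G$ is odd-bipartite if $V(G)$ can be partitioned into two disjoint sets $V_1,V_2$ such that each edge intersects each of $V_1$ and $V_2$ in an odd number of vertices. $G$ is regular if all vertices lie in the same number of edges. The adjacency tensor $\mathcal{A}(G)=(a_{i_1\dots i_k})$ has order $k$ and dimension $|V(G)|$, with $a_{i_1\dots i_k}=\frac{1}{(k-1)!}$ if $\{i_1,\dots,i_k\}\in E(G)$ and $0$ otherwise. A real number $\lambda$ is an H-eigenvalue of $\mathcal{A}(G)$ with H-eigenvector $\mathbf{x}$ (a nonzero real vector indexed by $V(G)$) if $\lambda x_u^{k-1}=\sum_{e\in E(G),\,u\in e}\prod_{w\in e\setminus\{u\}}x_w$ for all $u\in V(G)$. $\lambda(G)$ denotes the least H-eigenvalue of $\mathcal{A}(G)$. A least eigenvector of $G$ is a real vector $\mathbf{x}$ with $\sum_i|x_i|^k=1$ that is an eigenvector of $\mathcal{A}(G)$ associated with $\lambda(G)$. *)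

theory Defs
  imports Complex_Main "HOL-Combinatorics.Multiset_Permutations"
begin

definition uniform_hypergraph :: "nat \<Rightarrow> 'a set \<Rightarrow> 'a set set \<Rightarrow> bool" where
  "uniform_hypergraph k V E \<longleftrightarrow> finite V \<and> (\<forall>e\<in>E. e \<subseteq> V \<and> card e = k)"

definition odd_bipartite :: "'a set \<Rightarrow> 'a set set \<Rightarrow> bool" where
  "odd_bipartite V E \<longleftrightarrow>
     (\<exists>V1 V2. V1 \<union> V2 = V \<and> V1 \<inter> V2 = {} \<and>
        (\<forall>e\<in>E. odd (card (e \<inter> V1)) \<and> odd (card (e \<inter> V2))))"

text \<open>Any two vertices are joined by a walk \<open>v\<^sub>0 e\<^sub>1 v\<^sub>1 \<dots> e\<^sub>t v\<^sub>t\<close> with \<open>v\<^sub>i\<^sub>-\<^sub>1, v\<^sub>i \<in> e\<^sub>i\<close>.\<close>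

definition connected_hypergraph :: "'a set \<Rightarrow> 'a set set \<Rightarrow> bool" where
  "connected_hypergraph V E \<longleftrightarrow>
     (\<forall>u\<in>V. \<forall>v\<in>V. (\<lambda>a b. \<exists>e\<in>E. a \<in> e \<and> b \<in> e)\<^sup>*\<^sup>* u v)"

definition regular_hypergraph :: "'a set \<Rightarrow> 'a set set \<Rightarrow> bool" where
  "regular_hypergraph V E \<longleftrightarrow> (\<exists>d. \<forall>v\<in>V. card {e\<in>E. v \<in> e} = d)"

text \<open>A tensor of order \<open>k\<close> with indices in \<open>V\<close> is represented by its entries on the lists
  of length \<open>k\<close> over \<open>V\<close>, and a vector indexed by \<open>V\<close> by a function of which only the values
  on \<open>V\<close> are ever used.\<close>

definition adjacency_tensor :: "nat \<Rightarrow> 'a set set \<Rightarrow> 'a list \<Rightarrow> real" where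
  "adjacency_tensor k E is = (if length is = k \<and> set is \<in> E then 1 / fact (k - 1) else 0)"

text \<open>The component \<open>(T x\<^sup>k\<^sup>-\<^sup>1)\<^sub>u\<close>, the sum of \<open>T\<^sub>u\<^sub>i\<^sub>2\<^sub>\<dots>\<^sub>i\<^sub>k x\<^sub>i\<^sub>2 \<cdots> x\<^sub>i\<^sub>k\<close> over all indices \<open>i\<^sub>2, \<dots>, i\<^sub>k\<close>.\<close>

definition tensor_apply ::
  "nat \<Rightarrow> 'a set \<Rightarrow> ('a list \<Rightarrow> real) \<Rightarrow> ('a \<Rightarrow> real) \<Rightarrow> 'a \<Rightarrow> real" where
  "tensor_apply k V T x u =
     (\<Sum>is | set is \<subseteq> V \<and> length is = k - 1. T (u # is) * prod_list (map x is))"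

definition H_eigenvector ::
  "nat \<Rightarrow> 'a set \<Rightarrow> ('a list \<Rightarrow> real) \<Rightarrow> real \<Rightarrow> ('a \<Rightarrow> real) \<Rightarrow> bool" where
  "H_eigenvector k V T l x \<longleftrightarrow>
     (\<exists>v\<in>V. x v \<noteq> 0) \<and> (\<forall>u\<in>V. tensor_apply k V T x u = l * x u ^ (k - 1))"

definition least_H_eigenvalue :: "nat \<Rightarrow> 'a set \<Rightarrow> 'a set set \<Rightarrow> real" where
  "least_H_eigenvalue k V E = (LEAST l. \<exists>x. H_eigenvector k V (adjacency_tensor k E) l x)"

definition least_eigenvector :: "nat \<Rightarrow> 'a set \<Rightarrow> 'a set set \<Rightarrow> ('a \<Rightarrow> real) \<Rightarrow> bool" where
  "least_eigenvector k V E x \<longleftrightarrow>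
     H_eigenvector k V (adjacency_tensor k E) (least_H_eigenvalue k V E) x \<and>
     (\<Sum>v\<in>V. \<bar>x v\<bar> ^ k) = 1"

definition c_max :: "nat \<Rightarrow> 'a set \<Rightarrow> 'a set set \<Rightarrow> real" where
  "c_max k V E = (GREATEST c. \<exists>x. least_eigenvector k V E x \<and> (\<exists>v\<in>V. c = x v))"

text \<open>For the adjacency tensor, the entry \<open>1 / (k - 1)!\<close> cancels the number of orderings of
  \<open>e - {u}\<close>, which gives the edge form of the eigenvalue equations.\<close>

lemma tensor_apply_adjacency_tensor:
  assumes G: "uniform_hypergraph k V E" and k: "k \<ge> 1" and u: "u \<in> V"
  shows "tensor_apply k V (adjacency_tensor k E) x u = (\<Sum>e | e \<in> E \<and> u \<in> e. \<Prod>w\<in>e - {u}. x w)"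
proof -
  let ?L = "{is. set is \<subseteq> V \<and> length is = k - 1}"
  let ?F = "{e. e \<in> E \<and> u \<in> e}"
  let ?P = "\<lambda>e. permutations_of_set (e - {u})"
  have finV: "finite V" and E: "\<And>e. e \<in> E \<Longrightarrow> e \<subseteq> V \<and> card e = k"
    using G by (auto simp: uniform_hypergraph_def)
  have fine: "finite e" if "e \<in> E" for e
    using E[OF that] finV finite_subset by blast
  have finL: "finite ?L" using finite_lists_length_eq[OF finV] by simp
  have "finite E" using E finV by (intro finite_subset[of E "Pow V"]) auto
  hence finF: "finite ?F" by simp
  have split: "{is \<in> ?L. set (u # is) \<in> E} = (\<Union>e\<in>?F. ?P e)" (is "?A = ?B")
  proof (intro equalityI subsetI)
    fix js assume js: "js \<in> ?A"
    let ?e = "insert u (set js)"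
    have e: "?e \<in> E" using js by simp
    have "card ?e = k" using E[OF e] by blast
    moreover have len: "length (u # js) = k" using js k by simp
    ultimately have "distinct (u # js)" by (intro card_distinct) simp
    hence "js \<in> ?P ?e" by (auto simp: permutations_of_set_def)
    with e show "js \<in> ?B" by blast
  next
    fix js assume "js \<in> ?B"
    then obtain e where e: "e \<in> E" "u \<in> e" and js: "set js = e - {u}" "distinct js"
      by (auto simp: permutations_of_set_def)
    have "length js = card (e - {u})" using js distinct_card by fastforce
    also have "\<dots> = k - 1" using E[OF e(1)] e(2) by (simp add: fine[OF e(1)])
    finally have "length js = k - 1" .
    moreover have "insert u (set js) = e" using js e by auto
    ultimately show "js \<in> ?A" using E[OF e(1)] e(1) js by auto
  qed
  have "tensor_apply k V (adjacency_tensor k E) x u =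
      (\<Sum>is\<in>{is \<in> ?L. set (u # is) \<in> E}. 1 / fact (k - 1) * prod_list (map x is))"
    unfolding tensor_apply_def
    by (rule sum.mono_neutral_cong_right[OF finL]) (use k in \<open>auto simp: adjacency_tensor_def\<close>)
  also have "\<dots> = (\<Sum>e\<in>?F. \<Sum>is\<in>?P e. 1 / fact (k - 1) * prod_list (map x is))"
    unfolding split
  proof (rule sum.UNION_disjoint)
    show "\<forall>e\<in>?F. \<forall>f\<in>?F. e \<noteq> f \<longrightarrow> ?P e \<inter> ?P f = {}"
    proof (intro ballI impI)
      fix e f assume "e \<in> ?F" "f \<in> ?F" "e \<noteq> f"
      hence "e - {u} \<noteq> f - {u}" by blast
      thus "?P e \<inter> ?P f = {}" by (fastforce simp: permutations_of_set_def)
    qed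
  next
    show "finite ?F" by (fact finF)
  next
    show "\<forall>e\<in>?F. finite (?P e)" by simp
  qed
  also have "\<dots> = (\<Sum>e\<in>?F. \<Prod>w\<in>e - {u}. x w)"
  proof (rule sum.cong[OF refl])
    fix e assume e: "e \<in> ?F"
    have "prod_list (map x is) = (\<Prod>w\<in>e - {u}. x w)" if "is \<in> ?P e" for "is"
      using prod.distinct_set_conv_list[of "is" x] permutations_of_setD[OF that] by simp
    moreover have "card (?P e) = fact (k - 1)"
    proof -
      have "card (e - {u}) = k - 1" using e E[of e] fine[of e] by simp
      thus ?thesis using e fine[of e] by simp
    qed
    ultimately show "(\<Sum>is\<in>?P e. 1 / fact (k - 1) * prod_list (map x is)) = (\<Prod>w\<in>e - {u}. x w)"
      by simp
  qed
  finally show ?thesis .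
qed

lemma H_eigenvector_adjacency_tensor:
  assumes "uniform_hypergraph k V E" and "k \<ge> 1"
  shows "H_eigenvector k V (adjacency_tensor k E) l x \<longleftrightarrow>
    (\<exists>v\<in>V. x v \<noteq> 0) \<and>
    (\<forall>u\<in>V. l * x u ^ (k - 1) = (\<Sum>e | e \<in> E \<and> u \<in> e. \<Prod>w\<in>e - {u}. x w))"
  using tensor_apply_adjacency_tensor[OF assms] by (auto simp: H_eigenvector_def)

end

theory Submission
  imports Defs "HOL-Analysis.Function_Topology"
begin

text \<open>Write \<open>F x = k \<cdot> (\<Sum>e\<in>E. \<Prod>w\<in>e. x w)\<close> and \<open>N x = (\<Sum>v\<in>V. x v ^ k)\<close>. Both are
  homogeneous of degree \<open>k\<close>, and for even \<open>k\<close> the set \<open>N x = 1\<close> is compact. Multiplying the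
  eigenvalue equation at \<open>u\<close> by \<open>x u\<close> and summing over \<open>u\<close> gives \<open>F x = l \<cdot> N x\<close> for every
  eigenpair \<open>(l, x)\<close>. Conversely, if \<open>\<mu>\<close> is the minimum of \<open>F\<close> on \<open>N x = 1\<close>, then
  \<open>F - \<mu> \<cdot> N\<close> is nonnegative on the whole space and vanishes at a minimiser, so its partial
  derivatives vanish there; these are the eigenvalue equations for \<open>\<mu>\<close>. Hence the least
  eigenvalue is \<open>\<mu>\<close> and the least eigenvectors are exactly the minimisers
  (\<open>least_eigenvector_iff\<close>). They form a compact set, so \<open>c_max\<close> is attained, and as \<open>F\<close> and
  \<open>N\<close> are even, \<open>c_max\<close> bounds the absolute values of all their components.

  If \<open>c\<close> is the largest absolute value of a component of a least eigenvector \<open>x\<close>, then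
  \<open>-\<mu> = -F x \<le> k m c ^ k\<close>, since each of the \<open>m\<close> products is at least \<open>-(c ^ k)\<close>. This is
  the inequality. In the case of equality every product is \<open>-(c ^ k)\<close>. As connectedness
  puts every vertex on an edge, \<open>\<bar>x\<bar> = c\<close> everywhere, and the eigenvalue equation at \<open>u\<close> then
  says that \<open>u\<close> has degree \<open>-\<mu>\<close>.

  The converse rests on the odd bipartition. If \<open>G\<close> is \<open>d\<close>-regular, the \<open>\<plusminus>1\<close> vector of the
  bipartition is an eigenvector for \<open>-d\<close>, so \<open>\<mu> \<le> -d\<close>. Take any least eigenvector \<open>x\<close> and a
  vertex where \<open>\<bar>x\<bar>\<close> attains its maximum \<open>c\<close>. With the triangle inequality, the eigenvalue
  equation there gives \<open>d c ^ (k - 1) \<le> -\<mu> c ^ (k - 1) \<le> d c ^ (k - 1)\<close>, so \<open>\<mu> = -d\<close> and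
  \<open>\<bar>x\<bar> = c\<close> on all neighbours of that vertex. Connectedness spreads this to all of \<open>V\<close>, and then
  \<open>card V \<cdot> c ^ k = 1\<close> together with \<open>d \<cdot> card V = k m\<close> gives the value of \<open>c\<close>.\<close>


section \<open>Products of bounded reals\<close>

lemma abs_prod_le_power:
  fixes x :: "'a \<Rightarrow> real"
  assumes "\<And>w. w \<in> A \<Longrightarrow> \<bar>x w\<bar> \<le> c"
  shows "\<bar>\<Prod>w\<in>A. x w\<bar> \<le> c ^ card A"
proof -
  have "\<bar>\<Prod>w\<in>A. x w\<bar> = (\<Prod>w\<in>A. \<bar>x w\<bar>)"
    by (rule abs_prod)
  also have "\<dots> \<le> (\<Prod>w\<in>A. c)"
    by (rule prod_mono) (use assms in auto)
  finally show ?thesis by simp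
qed

text \<open>A single factor smaller than \<open>c\<close> in absolute value already makes the bound of
  \<open>abs_prod_le_power\<close> strict.\<close>

lemma abs_prod_eq_power_imp_abs_eq:
  fixes x :: "'a \<Rightarrow> real"
  assumes fin: "finite A" and le: "\<And>w. w \<in> A \<Longrightarrow> \<bar>x w\<bar> \<le> c"
    and c: "c > 0" and eq: "\<bar>\<Prod>w\<in>A. x w\<bar> = c ^ card A" and w: "w \<in> A"
  shows "\<bar>x w\<bar> = c"
proof (rule ccontr)
  assume "\<bar>x w\<bar> \<noteq> c"
  hence less: "\<bar>x w\<bar> < c" using le[OF w] by simp
  have "\<bar>\<Prod>w\<in>A. x w\<bar> = \<bar>x w\<bar> * \<bar>\<Prod>w\<in>A - {w}. x w\<bar>"
    using prod.remove[OF fin w, of x] by (simp add: abs_mult)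
  also have "\<dots> \<le> \<bar>x w\<bar> * c ^ card (A - {w})"
    by (intro mult_left_mono abs_prod_le_power) (use le in auto)
  also have "\<dots> < c * c ^ card (A - {w})"
    using less c by simp
  also have "\<dots> = c ^ card A"
    using card_Suc_Diff1[OF fin w] by (metis power_Suc)
  finally show False using eq by simp
qed


section \<open>Connectedness and the odd bipartition\<close>

text \<open>The form in which connectedness is used: a property of one vertex that passes to all
  vertices of a common edge holds everywhere.\<close>

lemma connected_hypergraph_closed_set:
  assumes con: "connected_hypergraph V E" and u: "u \<in> V" "u \<in> A"
    and closed: "\<And>e a. e \<in> E \<Longrightarrow> a \<in> e \<Longrightarrow> a \<in> A \<Longrightarrow> e \<subseteq> A"
  shows "V \<subseteq> A"
proof
  fix v assume "v \<in> V"
  hence "(\<lambda>a b. \<exists>e\<in>E. a \<in> e \<and> b \<in> e)\<^sup>*\<^sup>* u v"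
    using con u by (auto simp: connected_hypergraph_def)
  thus "v \<in> A"
    by induction (use u closed in auto)
qed

text \<open>Give one part the sign \<open>-1\<close>; each edge then contains an odd number of minus signs.\<close>

lemma odd_bipartite_sign_vector:
  fixes V :: "'a set"
  assumes "odd_bipartite V E" and "uniform_hypergraph k V E"
  obtains s :: "'a \<Rightarrow> real"
    where "\<And>v. \<bar>s v\<bar> = 1" and "\<And>e. e \<in> E \<Longrightarrow> (\<Prod>w\<in>e. s w) = -1"
proof -
  obtain V1 where V1: "\<And>e. e \<in> E \<Longrightarrow> odd (card (e \<inter> V1))"
    using assms by (auto simp: odd_bipartite_def)
  define s :: "'a \<Rightarrow> real" where "s v = (if v \<in> V1 then -1 else 1)" for v
  have "(\<Prod>w\<in>e. s w) = -1" if "e \<in> E" for e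
  proof -
    have "finite e"
      using assms(2) that by (auto simp: uniform_hypergraph_def intro: finite_subset)
    hence "(\<Prod>w\<in>e. s w) = (\<Prod>w\<in>e \<inter> V1. -1)"
      unfolding s_def by (rule prod.inter_restrict[symmetric])
    thus ?thesis using V1[OF that] by simp
  qed
  moreover have "\<bar>s v\<bar> = 1" for v by (simp add: s_def)
  ultimately show ?thesis using that by blast
qed


section \<open>The form of the adjacency tensor\<close>

locale even_uniform_hypergraph =
  fixes k :: nat and V :: "'a set" and E :: "'a set set"
  assumes k_ge_2: "k \<ge> 2" and even_k: "even k"
    and uniform: "uniform_hypergraph k V E"
    and V_nonempty: "V \<noteq> {}"
begin

text \<open>For the adjacency tensor \<open>T\<close> this is \<open>\<Sum>u. x u \<cdot> (T x ^ (k - 1)) u\<close>: every edge is counted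
  once at each of its \<open>k\<close> vertices.\<close>

definition tensor_form :: "('a \<Rightarrow> real) \<Rightarrow> real" where
  "tensor_form x = real k * (\<Sum>e\<in>E. \<Prod>w\<in>e. x w)"

text \<open>As \<open>k\<close> is even, this is the \<open>k\<close>-th power of the \<open>k\<close>-norm, written as a polynomial.\<close>

definition power_sum :: "('a \<Rightarrow> real) \<Rightarrow> real" where
  "power_sum x = (\<Sum>v\<in>V. x v ^ k)"

abbreviation least :: real where
  "least \<equiv> least_H_eigenvalue k V E"

abbreviation link_sum :: "('a \<Rightarrow> real) \<Rightarrow> 'a \<Rightarrow> real" where
  "link_sum x u \<equiv> (\<Sum>e | e \<in> E \<and> u \<in> e. \<Prod>w\<in>e - {u}. x w)"

lemma finite_V: "finite V"
  and edge_subset: "e \<in> E \<Longrightarrow> e \<subseteq> V"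
  and card_edge: "e \<in> E \<Longrightarrow> card e = k"
  using uniform by (auto simp: uniform_hypergraph_def)

lemma finite_edge: "e \<in> E \<Longrightarrow> finite e"
  using edge_subset finite_V finite_subset by blast

lemma finite_E: "finite E"
  using edge_subset finite_V by (intro finite_subset[of E "Pow V"]) auto

lemma k_pos: "k > 0"
  using k_ge_2 by simp

lemma odd_k1: "odd (k - 1)"
  using k_ge_2 even_k by simp

lemma card_edge_minus: "e \<in> E \<Longrightarrow> u \<in> e \<Longrightarrow> card (e - {u}) = k - 1"
  using card_edge finite_edge by simp

lemma eigenvector_iff:
  "H_eigenvector k V (adjacency_tensor k E) l x \<longleftrightarrow>
    (\<exists>v\<in>V. x v \<noteq> 0) \<and> (\<forall>u\<in>V. l * x u ^ (k - 1) = link_sum x u)"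
  using H_eigenvector_adjacency_tensor[OF uniform] k_ge_2 by simp

lemma power_abs_eq: "\<bar>t :: real\<bar> ^ k = t ^ k"
  using even_k by (rule power_even_abs)

lemma power_sum_nonneg: "power_sum x \<ge> 0"
  unfolding power_sum_def by (intro sum_nonneg zero_le_even_power even_k)

lemma power_sum_eq_0_iff: "power_sum x = 0 \<longleftrightarrow> (\<forall>v\<in>V. x v = 0)"
  unfolding power_sum_def using k_pos
  by (subst sum_nonneg_eq_0_iff) (auto simp: finite_V intro: zero_le_even_power even_k)

lemma sum_over_incident_edges:
  fixes f :: "'a set \<Rightarrow> real"
  shows "(\<Sum>u\<in>V. \<Sum>e | e \<in> E \<and> u \<in> e. f e) = real k * (\<Sum>e\<in>E. f e)"
proof -
  have "(\<Sum>u\<in>V. \<Sum>e | e \<in> E \<and> u \<in> e. f e) = (\<Sum>e\<in>E. \<Sum>u | u \<in> V \<and> u \<in> e. f e)"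
    by (rule sum.swap_restrict[OF finite_V finite_E])
  also have "\<dots> = (\<Sum>e\<in>E. real k * f e)"
  proof (rule sum.cong[OF refl])
    fix e assume e: "e \<in> E"
    have "{u. u \<in> V \<and> u \<in> e} = e" using edge_subset[OF e] by blast
    thus "(\<Sum>u | u \<in> V \<and> u \<in> e. f e) = real k * f e"
      using card_edge[OF e] by simp
  qed
  finally show ?thesis by (simp add: sum_distrib_left)
qed

lemma times_link_sum: "x u * link_sum x u = (\<Sum>e | e \<in> E \<and> u \<in> e. \<Prod>w\<in>e. x w)"
  unfolding sum_distrib_left
  by (rule sum.cong) (auto simp: prod.remove[OF finite_edge])

lemma power_k_eq: "(t :: real) ^ k = t * t ^ (k - 1)"
  using k_pos by (metis Suc_pred' power_Suc)

lemma eigenvalue_times_power: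
  assumes "l * x u ^ (k - 1) = link_sum x u"
  shows "l * x u ^ k = (\<Sum>e | e \<in> E \<and> u \<in> e. \<Prod>w\<in>e. x w)"
proof -
  have "l * x u ^ k = x u * (l * x u ^ (k - 1))"
    by (simp only: power_k_eq[of "x u"] mult_ac)
  thus ?thesis by (simp only: assms times_link_sum)
qed

lemma tensor_form_eigenvector:
  assumes "\<forall>u\<in>V. l * x u ^ (k - 1) = link_sum x u"
  shows "tensor_form x = l * power_sum x"
proof -
  have "l * power_sum x = (\<Sum>u\<in>V. l * x u ^ k)"
    by (simp add: power_sum_def sum_distrib_left)
  also have "\<dots> = (\<Sum>u\<in>V. \<Sum>e | e \<in> E \<and> u \<in> e. \<Prod>w\<in>e. x w)"
    by (rule sum.cong) (use assms eigenvalue_times_power in auto)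
  finally show ?thesis
    by (simp add: tensor_form_def sum_over_incident_edges)
qed

lemma tensor_form_cong:
  assumes "\<And>v. v \<in> V \<Longrightarrow> x v = y v"
  shows "tensor_form x = tensor_form y"
proof -
  have "(\<Prod>w\<in>e. x w) = (\<Prod>w\<in>e. y w)" if "e \<in> E" for e
    by (rule prod.cong) (use assms edge_subset[OF that] in auto)
  thus ?thesis by (simp add: tensor_form_def)
qed

lemma power_sum_cong:
  assumes "\<And>v. v \<in> V \<Longrightarrow> x v = y v"
  shows "power_sum x = power_sum y"
  using assms by (simp add: power_sum_def)

lemma tensor_form_scale: "tensor_form (\<lambda>v. c * x v) = c ^ k * tensor_form x"
proof -
  have "(\<Prod>w\<in>e. c * x w) = c ^ k * (\<Prod>w\<in>e. x w)" if "e \<in> E" for e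
    using card_edge[OF that] by (simp add: prod.distrib)
  hence "(\<Sum>e\<in>E. \<Prod>w\<in>e. c * x w) = c ^ k * (\<Sum>e\<in>E. \<Prod>w\<in>e. x w)"
    by (simp add: sum_distrib_left)
  thus ?thesis by (simp add: tensor_form_def)
qed

lemma power_sum_scale: "power_sum (\<lambda>v. c * x v) = c ^ k * power_sum x"
  by (simp add: power_sum_def power_mult_distrib sum_distrib_left)


section \<open>Minimisers of the form\<close>

text \<open>Vectors are functions on the whole type; fixing the value \<open>0\<close> outside \<open>V\<close> makes the unit
  sphere compact in the product topology.\<close>

definition unit_sphere :: "('a \<Rightarrow> real) set" where
  "unit_sphere = {x. (\<forall>v. v \<notin> V \<longrightarrow> x v = 0) \<and> power_sum x = 1}"

lemma restrict_unit_sphere: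
  assumes "power_sum x = 1"
  shows "(\<lambda>v. if v \<in> V then x v else 0) \<in> unit_sphere"
proof -
  have "power_sum (\<lambda>v. if v \<in> V then x v else 0) = power_sum x"
    by (rule power_sum_cong) simp
  thus ?thesis using assms by (simp add: unit_sphere_def)
qed

lemma continuous_on_coordinate: "continuous_on S (\<lambda>x :: 'a \<Rightarrow> real. x v)"
  by (rule continuous_on_subset[OF continuous_on_product_coordinates]) simp

lemma continuous_on_tensor_form: "continuous_on S tensor_form"
  unfolding tensor_form_def[abs_def] by (intro continuous_intros continuous_on_coordinate)

lemma continuous_on_power_sum: "continuous_on S power_sum"
  unfolding power_sum_def[abs_def] by (intro continuous_intros continuous_on_coordinate)

lemma compact_unit_sphere: "compact unit_sphere"
proof -
  let ?B = "PiE UNIV (\<lambda>v. if v \<in> V then {-1..1} else {0 :: real})"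
  have "compactin (product_topology (\<lambda>_. euclidean) UNIV) ?B"
    by (subst compactin_PiE) auto
  hence "compact ?B"
    by (simp add: euclidean_product_topology)
  moreover have "closed {x. power_sum x = 1}"
    by (intro closed_Collect_eq continuous_on_power_sum continuous_intros)
  ultimately have "compact (?B \<inter> {x. power_sum x = 1})"
    by (rule compact_Int_closed)
  moreover have "unit_sphere = ?B \<inter> {x. power_sum x = 1}"
  proof -
    have "\<bar>x v\<bar> \<le> 1" if "power_sum x = 1" "v \<in> V" for x v
    proof -
      have "x v ^ k \<le> power_sum x"
        unfolding power_sum_def
        by (rule member_le_sum) (use that finite_V even_k in \<open>auto intro: zero_le_even_power\<close>)
      hence "\<bar>x v\<bar> ^ k \<le> 1 ^ k" using that by (simp add: power_abs_eq)
      thus ?thesis using power_le_imp_le_base k_pos by (metis Suc_pred' zero_le_one)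
    qed
    thus ?thesis
      by (fastforce simp: unit_sphere_def PiE_iff abs_le_iff split: if_splits)
  qed
  ultimately show ?thesis by simp
qed

lemma unit_sphere_nonempty: "unit_sphere \<noteq> {}"
proof -
  obtain v where v: "v \<in> V" using V_nonempty by blast
  have "power_sum (\<lambda>u. if u = v then 1 else 0) = (\<Sum>u\<in>V. if u = v then 1 else 0)"
    unfolding power_sum_def by (rule sum.cong) (use k_pos in auto)
  also have "\<dots> = 1" using v finite_V by simp
  finally show ?thesis using restrict_unit_sphere by blast
qed

text \<open>Homogeneity carries the lower bound from the unit sphere to the whole space.\<close>

lemma exists_minimiser:
  shows "\<exists>x. power_sum x = 1 \<and> (\<forall>y. tensor_form x * power_sum y \<le> tensor_form y)"
proof -
  obtain x where x: "x \<in> unit_sphere" "\<forall>y\<in>unit_sphere. tensor_form x \<le> tensor_form y"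
    using continuous_attains_inf[OF compact_unit_sphere unit_sphere_nonempty
        continuous_on_tensor_form] by blast
  have "tensor_form x * power_sum y \<le> tensor_form y" for y
  proof (cases "power_sum y = 0")
    case True
    hence "tensor_form y = tensor_form (\<lambda>v. 0 * y v)"
      by (intro tensor_form_cong) (simp add: power_sum_eq_0_iff)
    also have "\<dots> = 0" using k_pos by (simp only: tensor_form_scale) simp
    finally show ?thesis using True by simp
  next
    case False
    hence pos: "power_sum y > 0" using power_sum_nonneg[of y] by simp
    define c where "c = 1 / root k (power_sum y)"
    have ck: "c ^ k = 1 / power_sum y"
      using pos k_pos by (simp add: c_def power_divide)
    let ?z = "\<lambda>v. if v \<in> V then c * y v else 0"
    have "power_sum (\<lambda>v. c * y v) = 1"
      using pos by (simp add: power_sum_scale ck)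
    hence "tensor_form x \<le> tensor_form ?z"
      using x restrict_unit_sphere by blast
    also have "\<dots> = tensor_form (\<lambda>v. c * y v)"
      by (rule tensor_form_cong) simp
    also have "\<dots> = tensor_form y / power_sum y"
      by (simp add: tensor_form_scale ck)
    finally show ?thesis using pos by (simp add: field_simps)
  qed
  moreover have "power_sum x = 1" using x(1) by (simp add: unit_sphere_def)
  ultimately show ?thesis by blast
qed

text \<open>No product over an edge contains a coordinate twice, so the form is affine in each
  coordinate, with \<open>k\<close> times the link sum as slope.\<close>

lemma tensor_form_fun_upd:
  "tensor_form (x(u := t)) =
    real k * ((\<Sum>e | e \<in> E \<and> u \<notin> e. \<Prod>w\<in>e. x w) + t * link_sum x u)"
proof -
  let ?f = "\<lambda>e. \<Prod>w\<in>e. (x(u := t)) w"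
  have "(\<Sum>e\<in>E. ?f e) = (\<Sum>e | e \<in> E \<and> u \<notin> e. ?f e) + (\<Sum>e | e \<in> E \<and> u \<in> e. ?f e)"
    by (subst sum.union_disjoint[symmetric]) (auto intro!: sum.cong simp: finite_E)
  moreover have "(\<Sum>e | e \<in> E \<and> u \<notin> e. ?f e) = (\<Sum>e | e \<in> E \<and> u \<notin> e. \<Prod>w\<in>e. x w)"
    by (intro sum.cong prod.cong) auto
  moreover have "(\<Sum>e | e \<in> E \<and> u \<in> e. ?f e) = t * link_sum x u"
    unfolding sum_distrib_left
  proof (rule sum.cong[OF refl])
    fix e assume "e \<in> {e. e \<in> E \<and> u \<in> e}"
    hence e: "e \<in> E" "u \<in> e" by auto
    have "?f e = t * (\<Prod>w\<in>e - {u}. (x(u := t)) w)"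
      using prod.remove[OF finite_edge[OF e(1)] e(2), of "x(u := t)"] by simp
    also have "(\<Prod>w\<in>e - {u}. (x(u := t)) w) = (\<Prod>w\<in>e - {u}. x w)"
      by (rule prod.cong) auto
    finally show "?f e = t * (\<Prod>w\<in>e - {u}. x w)" .
  qed
  ultimately show ?thesis by (simp add: tensor_form_def)
qed

lemma power_sum_fun_upd:
  assumes "u \<in> V"
  shows "power_sum (x(u := t)) = t ^ k + (\<Sum>v\<in>V - {u}. x v ^ k)"
proof -
  have "power_sum (x(u := t)) = t ^ k + (\<Sum>v\<in>V - {u}. (x(u := t)) v ^ k)"
    using sum.remove[OF finite_V assms, of "\<lambda>v. (x(u := t)) v ^ k"]
    by (simp add: power_sum_def)
  thus ?thesis by simp
qed

text \<open>The eigenvalue equations are the stationarity conditions of the nonnegative function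
  \<open>tensor_form - \<mu> \<cdot> power_sum\<close> at a zero.\<close>

lemma minimiser_eigenvalue_equation:
  assumes bound: "\<And>y. \<mu> * power_sum y \<le> tensor_form y"
    and zero: "tensor_form x = \<mu> * power_sum x" and u: "u \<in> V"
  shows "\<mu> * x u ^ (k - 1) = link_sum x u"
proof -
  define A where "A = (\<Sum>e | e \<in> E \<and> u \<notin> e. \<Prod>w\<in>e. x w)"
  define C where "C = (\<Sum>v\<in>V - {u}. x v ^ k)"
  define f where "f t = real k * (A + t * link_sum x u) - \<mu> * (t ^ k + C)" for t
  have f: "f t = tensor_form (x(u := t)) - \<mu> * power_sum (x(u := t))" for t
    by (simp only: f_def A_def C_def tensor_form_fun_upd power_sum_fun_upd[OF u])
  have min: "f (x u) \<le> f t" for t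
    using bound[of "x(u := t)"] zero by (simp add: f)
  have "(f has_real_derivative
      real k * link_sum x u - \<mu> * (real k * x u ^ (k - 1))) (at (x u))"
    unfolding f_def by (auto intro!: derivative_eq_intros)
  hence "real k * link_sum x u - \<mu> * (real k * x u ^ (k - 1)) = 0"
    by (rule DERIV_local_min[where d = 1]) (use min in auto)
  thus ?thesis using k_pos by (simp add: algebra_simps)
qed


section \<open>Least eigenvectors\<close>

text \<open>Since \<open>tensor_form = l \<cdot> power_sum\<close> at every eigenpair, the global bound of a minimiser
  rules out smaller eigenvalues; this also shows that the minimum defining
  \<open>least_H_eigenvalue\<close> exists.\<close>

lemma least_is_minimum:
  shows "\<exists>x. power_sum x = 1 \<and> tensor_form x = least"
    and "least * power_sum y \<le> tensor_form y"
proof -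
  obtain x where x: "power_sum x = 1" "\<And>y. tensor_form x * power_sum y \<le> tensor_form y"
    using exists_minimiser by metis
  have "least = tensor_form x"
    unfolding least_H_eigenvalue_def
  proof (rule Least_equality)
    have "\<exists>v\<in>V. x v \<noteq> 0" using x(1) power_sum_eq_0_iff[of x] by auto
    hence "H_eigenvector k V (adjacency_tensor k E) (tensor_form x) x"
      using minimiser_eigenvalue_equation[OF x(2), of x] x(1) by (simp add: eigenvector_iff)
    thus "\<exists>y. H_eigenvector k V (adjacency_tensor k E) (tensor_form x) y" by blast
  next
    fix l assume "\<exists>y. H_eigenvector k V (adjacency_tensor k E) l y"
    then obtain y where y: "\<exists>v\<in>V. y v \<noteq> 0" "\<forall>u\<in>V. l * y u ^ (k - 1) = link_sum y u"
      by (auto simp: eigenvector_iff)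
    have "power_sum y > 0"
      using y(1) power_sum_eq_0_iff[of y] power_sum_nonneg[of y] by auto
    moreover have "tensor_form x * power_sum y \<le> l * power_sum y"
      using x(2)[of y] tensor_form_eigenvector[OF y(2)] by simp
    ultimately show "tensor_form x \<le> l" by simp
  qed
  thus "\<exists>x. power_sum x = 1 \<and> tensor_form x = least"
    and "least * power_sum y \<le> tensor_form y"
    using x by auto
qed

lemma least_le_eigenvalue:
  assumes "\<exists>v\<in>V. x v \<noteq> 0" and "\<forall>u\<in>V. l * x u ^ (k - 1) = link_sum x u"
  shows "least \<le> l"
proof -
  have "power_sum x > 0"
    using assms(1) power_sum_eq_0_iff[of x] power_sum_nonneg[of x] by auto
  thus ?thesis
    using least_is_minimum(2)[of x] tensor_form_eigenvector[OF assms(2)] by simp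
qed

text \<open>This variational description has no mention of the eigenvalue equations, so it makes
  compactness and the symmetry \<open>x \<mapsto> -x\<close> of the set of least eigenvectors evident.\<close>

lemma least_eigenvector_iff:
  "least_eigenvector k V E x \<longleftrightarrow> power_sum x = 1 \<and> tensor_form x = least"
proof
  assume "least_eigenvector k V E x"
  thus "power_sum x = 1 \<and> tensor_form x = least"
    using tensor_form_eigenvector[of least x]
    by (auto simp: least_eigenvector_def eigenvector_iff power_abs_eq power_sum_def)
next
  assume x: "power_sum x = 1 \<and> tensor_form x = least"
  have "\<forall>u\<in>V. least * x u ^ (k - 1) = link_sum x u"
    using minimiser_eigenvalue_equation[OF least_is_minimum(2)] x by simp
  moreover have "\<exists>v\<in>V. x v \<noteq> 0" using x power_sum_eq_0_iff[of x] by auto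
  ultimately show "least_eigenvector k V E x"
    using x by (simp add: least_eigenvector_def eigenvector_iff power_abs_eq power_sum_def)
qed

lemma exists_least_eigenvector: "\<exists>x. least_eigenvector k V E x"
  using least_is_minimum(1) least_eigenvector_iff by blast

lemma least_eigenvector_uminus:
  "least_eigenvector k V E x \<Longrightarrow> least_eigenvector k V E (\<lambda>v. - x v)"
  using tensor_form_scale[of "-1" x] power_sum_scale[of "-1" x] even_k
  by (simp add: least_eigenvector_iff)

lemma least_eigenvector_equation:
  "least_eigenvector k V E x \<Longrightarrow> u \<in> V \<Longrightarrow> least * x u ^ (k - 1) = link_sum x u"
  by (simp add: least_eigenvector_def eigenvector_iff)

text \<open>The greatest component exists because the components of the least eigenvectors form a
  finite union of continuous images of a compact set.\<close>

lemma c_max_attained_and_bound: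
  shows "\<exists>x. least_eigenvector k V E x \<and> (\<exists>v\<in>V. c_max k V E = x v)"
    and "least_eigenvector k V E x \<Longrightarrow> v \<in> V \<Longrightarrow> x v \<le> c_max k V E"
proof -
  define S where "S = unit_sphere \<inter> {x. tensor_form x = least}"
  let ?C = "\<Union>v\<in>V. (\<lambda>x. x v) ` S"
  have S_iff: "x \<in> S \<longleftrightarrow> (\<forall>v. v \<notin> V \<longrightarrow> x v = 0) \<and> least_eigenvector k V E x" for x
    by (auto simp: S_def unit_sphere_def least_eigenvector_iff)
  have C: "c \<in> ?C \<longleftrightarrow> (\<exists>x. least_eigenvector k V E x \<and> (\<exists>v\<in>V. c = x v))" for c
  proof
    assume "c \<in> ?C"
    thus "\<exists>x. least_eigenvector k V E x \<and> (\<exists>v\<in>V. c = x v)"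
      using S_iff by auto
  next
    assume "\<exists>x. least_eigenvector k V E x \<and> (\<exists>v\<in>V. c = x v)"
    then obtain x v where x: "least_eigenvector k V E x" "v \<in> V" "c = x v" by blast
    let ?z = "\<lambda>v. if v \<in> V then x v else 0"
    have "?z \<in> S"
      using x(1) restrict_unit_sphere[of x] tensor_form_cong[of x ?z]
      by (simp add: S_def least_eigenvector_iff)
    hence "?z v \<in> (\<lambda>x. x v) ` S" by (rule imageI)
    thus "c \<in> ?C" using x(2,3) by auto
  qed
  have "compact S"
    unfolding S_def
    by (intro compact_Int_closed compact_unit_sphere closed_Collect_eq
        continuous_on_tensor_form continuous_intros)
  hence "compact ?C"
    by (intro compact_UN finite_V compact_continuous_image continuous_on_coordinate)
  moreover have "?C \<noteq> {}"
  proof -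
    obtain x v where "least_eigenvector k V E x" "v \<in> V"
      using exists_least_eigenvector V_nonempty by blast
    hence "x v \<in> ?C" unfolding C by blast
    thus ?thesis by force
  qed
  ultimately obtain c where c: "c \<in> ?C" "\<forall>t\<in>?C. t \<le> c"
    using compact_attains_sup[of ?C] by metis
  have attained: "\<exists>x. least_eigenvector k V E x \<and> (\<exists>v\<in>V. c = x v)"
    using c(1) by (simp only: C)
  have upper: "t \<le> c" if "\<exists>x. least_eigenvector k V E x \<and> (\<exists>v\<in>V. t = x v)" for t
    using c(2) that by (simp only: C[symmetric])
  have "c_max k V E = c"
    unfolding c_max_def by (rule Greatest_equality, rule attained, rule upper)
  with attained show "\<exists>x. least_eigenvector k V E x \<and> (\<exists>v\<in>V. c_max k V E = x v)"
    by simp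
  show "x v \<le> c_max k V E" if "least_eigenvector k V E x" "v \<in> V"
    unfolding \<open>c_max k V E = c\<close> by (rule upper) (use that in blast)
qed

lemma abs_least_eigenvector_le_c_max:
  assumes "least_eigenvector k V E x" and "v \<in> V"
  shows "\<bar>x v\<bar> \<le> c_max k V E"
  using c_max_attained_and_bound(2)[OF assms]
    c_max_attained_and_bound(2)[OF least_eigenvector_uminus[OF assms(1)] assms(2)]
  by (simp add: abs_le_iff)

lemma c_max_pos: "c_max k V E > 0"
proof -
  obtain x where x: "least_eigenvector k V E x" using exists_least_eigenvector by blast
  then obtain v where "v \<in> V" "x v \<noteq> 0"
    using power_sum_eq_0_iff[of x] by (auto simp: least_eigenvector_iff)
  thus ?thesis using abs_least_eigenvector_le_c_max[OF x] by fastforce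
qed


section \<open>The bound and its equality case\<close>

lemma neg_edge_prod_le:
  assumes "least_eigenvector k V E x" and "e \<in> E"
  shows "- (\<Prod>w\<in>e. x w) \<le> c_max k V E ^ k"
proof -
  have "\<bar>\<Prod>w\<in>e. x w\<bar> \<le> c_max k V E ^ card e"
    by (rule abs_prod_le_power)
      (use assms abs_least_eigenvector_le_c_max edge_subset in blast)
  thus ?thesis using card_edge[OF assms(2)] by simp
qed

text \<open>The inequality of the theorem before taking roots: evaluate the form at a least
  eigenvector and bound each of its products by \<open>c_max ^ k\<close>.\<close>

lemma neg_least_le: "- least \<le> real k * (real (card E) * c_max k V E ^ k)"
proof -
  obtain x where x: "least_eigenvector k V E x" using exists_least_eigenvector by blast
  have "(\<Sum>e\<in>E. - (\<Prod>w\<in>e. x w)) \<le> (\<Sum>e\<in>E. c_max k V E ^ k)"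
    by (intro sum_mono neg_edge_prod_le x)
  hence "real k * (\<Sum>e\<in>E. - (\<Prod>w\<in>e. x w)) \<le> real k * (real (card E) * c_max k V E ^ k)"
    by (intro mult_left_mono) auto
  thus ?thesis
    using x by (simp add: least_eigenvector_iff tensor_form_def sum_negf)
qed

lemma edge_through_vertex:
  assumes "connected_hypergraph V E" and "E \<noteq> {}" and "v \<in> V"
  shows "\<exists>e\<in>E. v \<in> e"
proof -
  obtain e where e: "e \<in> E" using assms by blast
  hence "e \<noteq> {}" using card_edge k_pos by fastforce
  then obtain u where u: "u \<in> e" by blast
  have "V \<subseteq> \<Union>E"
    by (rule connected_hypergraph_closed_set[OF assms(1), of u]) (use e u edge_subset in auto)
  thus ?thesis using assms(3) by blast
qed

text \<open>Equality forces every edge product to be \<open>-(c_max ^ k)\<close>, hence every component to have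
  absolute value \<open>c_max\<close>, because connectedness puts every vertex on some edge. The eigenvalue
  equation at a vertex, multiplied by its component, then counts the edges through it.\<close>

lemma equality_imp_regular:
  assumes con: "connected_hypergraph V E" and nonempty: "E \<noteq> {}"
    and eq: "- least = real k * (real (card E) * c_max k V E ^ k)"
  shows "regular_hypergraph V E"
proof -
  let ?c = "c_max k V E"
  obtain x where x: "least_eigenvector k V E x" using exists_least_eigenvector by blast
  have "real k * (\<Sum>e\<in>E. - (\<Prod>w\<in>e. x w)) = real k * (\<Sum>e\<in>E. ?c ^ k)"
    using x eq by (simp add: least_eigenvector_iff tensor_form_def sum_negf)
  hence "(\<Sum>e\<in>E. - (\<Prod>w\<in>e. x w)) = (\<Sum>e\<in>E. ?c ^ k)"
    using k_pos by simp
  hence prod: "- (\<Prod>w\<in>e. x w) = ?c ^ k" if "e \<in> E" for e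
    by (rule sum_mono_inv) (use that x finite_E neg_edge_prod_le in auto)
  have degree: "real (card {e \<in> E. v \<in> e}) = - least" if v: "v \<in> V" for v
  proof -
    obtain e where e: "e \<in> E" "v \<in> e"
      using edge_through_vertex[OF con nonempty v] by blast
    have "\<bar>\<Prod>w\<in>e. x w\<bar> = ?c ^ card e"
      using prod[OF e(1)] card_edge[OF e(1)] c_max_pos
      by (metis abs_minus_cancel abs_of_pos zero_less_power)
    hence "\<bar>x v\<bar> = ?c"
      by (rule abs_prod_eq_power_imp_abs_eq[OF finite_edge[OF e(1)] _ c_max_pos _ e(2), rotated])
        (use e edge_subset abs_least_eigenvector_le_c_max[OF x] in blast)
    hence "least * ?c ^ k = least * x v ^ k"
      using power_abs_eq[of "x v"] by simp
    also have "\<dots> = (\<Sum>e | e \<in> E \<and> v \<in> e. \<Prod>w\<in>e. x w)"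
      by (rule eigenvalue_times_power[OF least_eigenvector_equation[OF x v]])
    also have "\<dots> = (\<Sum>e | e \<in> E \<and> v \<in> e. - (?c ^ k))"
      by (rule sum.cong) (use prod in force)+
    finally have "least * ?c ^ k = - real (card {e \<in> E. v \<in> e}) * ?c ^ k"
      by simp
    moreover have "?c ^ k \<noteq> 0" using c_max_pos by simp
    ultimately have "least = - real (card {e \<in> E. v \<in> e})"
      using mult_right_cancel[of "?c ^ k" least "- real (card {e \<in> E. v \<in> e})"] by blast
    thus ?thesis by simp
  qed
  have "card {e \<in> E. v \<in> e} = nat \<lfloor>- least\<rfloor>" if "v \<in> V" for v
    using degree[OF that] by (metis floor_of_nat nat_int)
  thus ?thesis by (auto simp: regular_hypergraph_def)
qed

text \<open>For a sign vector with product \<open>-1\<close> on every edge, the product over the rest of an edge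
  through \<open>u\<close> is \<open>- s u\<close>, and \<open>s u = s u ^ (k - 1)\<close> as \<open>k - 1\<close> is odd.\<close>

lemma least_le_neg_degree:
  assumes "odd_bipartite V E" and reg: "\<And>v. v \<in> V \<Longrightarrow> card {e \<in> E. v \<in> e} = d"
  shows "least \<le> - real d"
proof -
  obtain s :: "'a \<Rightarrow> real"
    where s: "\<And>v. \<bar>s v\<bar> = 1" "\<And>e. e \<in> E \<Longrightarrow> (\<Prod>w\<in>e. s w) = -1"
    using odd_bipartite_sign_vector[OF assms(1) uniform] by blast
  have cases: "s v = 1 \<or> s v = -1" for v using s(1)[of v] by linarith
  have "- real d * s u ^ (k - 1) = link_sum s u" if u: "u \<in> V" for u
  proof -
    have "(\<Prod>w\<in>e - {u}. s w) = - s u" if "e \<in> E" "u \<in> e" for e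
      using prod.remove[OF finite_edge[OF that(1)] that(2), of s] s(2)[OF that(1)] cases[of u]
      by auto
    hence "link_sum s u = (\<Sum>e | e \<in> E \<and> u \<in> e. - s u)"
      by (intro sum.cong) auto
    also have "\<dots> = - real d * s u" using reg[OF u] by simp
    also have "s u = s u ^ (k - 1)" using cases[of u] odd_k1 by auto
    finally show ?thesis by simp
  qed
  moreover have "\<exists>v\<in>V. s v \<noteq> 0"
    using V_nonempty cases by (metis ex_in_conv one_neq_zero neg_equal_0_iff_equal)
  ultimately show ?thesis by (intro least_le_eigenvalue) auto
qed

text \<open>At a vertex where \<open>\<bar>x\<bar>\<close> is maximal, the eigenvalue equation and \<open>least \<le> - d\<close> squeeze the
  link sum between equal bounds. Equality forces \<open>\<bar>x\<bar>\<close> to be maximal at all neighbours too, so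
  the set of such vertices is closed under edges.\<close>

lemma regular_imp_constant_abs:
  assumes con: "connected_hypergraph V E" and least: "least \<le> - real d"
    and reg: "\<And>v. v \<in> V \<Longrightarrow> card {e \<in> E. v \<in> e} = d"
    and x: "least_eigenvector k V E x"
  obtains c where "c > 0" "\<And>v. v \<in> V \<Longrightarrow> \<bar>x v\<bar> = c" "least = - real d"
proof -
  define c where "c = Max ((\<lambda>v. \<bar>x v\<bar>) ` V)"
  have le: "\<bar>x v\<bar> \<le> c" if "v \<in> V" for v
    unfolding c_def using that finite_V by simp
  have "c \<in> (\<lambda>v. \<bar>x v\<bar>) ` V"
    unfolding c_def using finite_V V_nonempty by (intro Max_in) auto
  then obtain v0 where v0: "v0 \<in> V" "\<bar>x v0\<bar> = c" by auto
  have c: "c > 0"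
  proof -
    obtain v where "v \<in> V" "x v \<noteq> 0"
      using x power_sum_eq_0_iff[of x] by (auto simp: least_eigenvector_iff)
    thus ?thesis using le[of v] by linarith
  qed
  have bound: "\<bar>\<Prod>w\<in>e - {u}. x w\<bar> \<le> c ^ (k - 1)" if "e \<in> E" "u \<in> e" for e u
    using abs_prod_le_power[of "e - {u}" x c] le edge_subset[OF that(1)] card_edge_minus[OF that]
    by auto
  have chain: "real d * c ^ (k - 1) \<le> - least * c ^ (k - 1)"
      "- least * c ^ (k - 1) \<le> (\<Sum>e | e \<in> E \<and> u \<in> e. \<bar>\<Prod>w\<in>e - {u}. x w\<bar>)"
      "(\<Sum>e | e \<in> E \<and> u \<in> e. \<bar>\<Prod>w\<in>e - {u}. x w\<bar>) \<le> (\<Sum>e | e \<in> E \<and> u \<in> e. c ^ (k - 1))"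
      "(\<Sum>e | e \<in> E \<and> u \<in> e. c ^ (k - 1)) = real d * c ^ (k - 1)"
    if u: "u \<in> V" "\<bar>x u\<bar> = c" for u
  proof -
    show "real d * c ^ (k - 1) \<le> - least * c ^ (k - 1)"
      using least c by (intro mult_right_mono) auto
    have "- least * c ^ (k - 1) = \<bar>least * x u ^ (k - 1)\<bar>"
      using least u by (simp add: abs_mult power_abs)
    also have "\<dots> = \<bar>link_sum x u\<bar>"
      using least_eigenvector_equation[OF x u(1)] by simp
    also have "\<dots> \<le> (\<Sum>e | e \<in> E \<and> u \<in> e. \<bar>\<Prod>w\<in>e - {u}. x w\<bar>)"
      by (rule sum_abs)
    finally show "- least * c ^ (k - 1) \<le> (\<Sum>e | e \<in> E \<and> u \<in> e. \<bar>\<Prod>w\<in>e - {u}. x w\<bar>)" .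
    show "(\<Sum>e | e \<in> E \<and> u \<in> e. \<bar>\<Prod>w\<in>e - {u}. x w\<bar>) \<le> (\<Sum>e | e \<in> E \<and> u \<in> e. c ^ (k - 1))"
      by (intro sum_mono bound) auto
    show "(\<Sum>e | e \<in> E \<and> u \<in> e. c ^ (k - 1)) = real d * c ^ (k - 1)"
      using reg[OF u(1)] by simp
  qed
  have "- least * c ^ (k - 1) = real d * c ^ (k - 1)"
    using chain[OF v0] by linarith
  hence "- least = real d"
    using c mult_right_cancel[of "c ^ (k - 1)" "- least" "real d"] by simp
  hence "least = - real d" by simp
  moreover have "V \<subseteq> {v. \<bar>x v\<bar> = c}"
  proof (rule connected_hypergraph_closed_set[OF con v0(1)])
    fix e u assume e: "e \<in> E" "u \<in> e" and u: "u \<in> {v. \<bar>x v\<bar> = c}"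
    have uV: "u \<in> V" using e edge_subset by blast
    have uc: "\<bar>x u\<bar> = c" using u by simp
    have "(\<Sum>e | e \<in> E \<and> u \<in> e. \<bar>\<Prod>w\<in>e - {u}. x w\<bar>) = (\<Sum>e | e \<in> E \<and> u \<in> e. c ^ (k - 1))"
      using chain[OF uV uc] by linarith
    hence "\<bar>\<Prod>w\<in>e - {u}. x w\<bar> = c ^ (k - 1)"
      by (rule sum_mono_inv) (use e bound finite_E in auto)
    hence "\<bar>\<Prod>w\<in>e - {u}. x w\<bar> = c ^ card (e - {u})"
      using card_edge_minus[OF e] by simp
    hence "\<bar>x w\<bar> = c" if "w \<in> e - {u}" for w
      by (rule abs_prod_eq_power_imp_abs_eq[rotated 3, OF _ that])
        (use e c finite_edge edge_subset le in auto)
    thus "e \<subseteq> {v. \<bar>x v\<bar> = c}" using u by blast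
  qed (use v0 in simp)
  ultimately show ?thesis using that c by blast
qed

text \<open>The constant absolute value \<open>c\<close> is determined by the normalisation \<open>card V \<cdot> c ^ k = 1\<close>;
  counting incidences gives \<open>d \<cdot> card V = k \<cdot> card E\<close>.\<close>

lemma regular_imp_equality:
  assumes "connected_hypergraph V E" and "odd_bipartite V E" and "regular_hypergraph V E"
  shows "- least = real k * (real (card E) * c_max k V E ^ k)"
proof -
  obtain d where reg: "\<And>v. v \<in> V \<Longrightarrow> card {e \<in> E. v \<in> e} = d"
    using assms(3) by (auto simp: regular_hypergraph_def)
  obtain x v where x: "least_eigenvector k V E x" "v \<in> V" "c_max k V E = x v"
    using c_max_attained_and_bound(1) by blast
  obtain c where c: "c > 0" "\<And>v. v \<in> V \<Longrightarrow> \<bar>x v\<bar> = c" and least: "least = - real d"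
    using regular_imp_constant_abs[OF assms(1) least_le_neg_degree[OF assms(2) reg] reg x(1)]
    by blast
  have cm: "c_max k V E = c" using x c(2)[of v] c_max_pos by simp
  have "power_sum x = (\<Sum>v\<in>V. c ^ k)"
    unfolding power_sum_def
    by (rule sum.cong[OF refl]) (metis c(2) power_abs_eq)
  hence norm: "real (card V) * c ^ k = 1"
    using x(1) by (simp add: least_eigenvector_iff)
  have "(\<Sum>u\<in>V. \<Sum>e | e \<in> E \<and> u \<in> e. 1 :: real) = (\<Sum>u\<in>V. real d)"
    by (rule sum.cong) (use reg in auto)
  hence handshake: "real (card V) * real d = real k * real (card E)"
    using sum_over_incident_edges[of "\<lambda>_. 1"] by simp
  have "- least = real d * (real (card V) * c ^ k)" using least norm by simp
  also have "\<dots> = (real (card V) * real d) * c ^ k" by (simp only: mult_ac)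
  also have "\<dots> = real k * (real (card E) * c_max k V E ^ k)"
    unfolding handshake cm by (rule mult.assoc)
  finally show ?thesis .
qed

end

theorem theorem5p5:
  fixes k m :: nat and V :: "'a set" and E :: "'a set set"
  assumes "k \<ge> 2" and "even k"
    and "uniform_hypergraph k V E"
    and "odd_bipartite V E"
    and "connected_hypergraph V E"
    and "m = card E" and "m \<ge> 1"
  shows "c_max k V E \<ge> root k (- least_H_eigenvalue k V E / (real k * real m)) \<and>
    (c_max k V E = root k (- least_H_eigenvalue k V E / (real k * real m))
       \<longleftrightarrow> regular_hypergraph V E)"
proof -
  have E: "E \<noteq> {}" using assms(6,7) by auto
  then obtain e where e: "e \<in> E" by blast
  hence "e \<subseteq> V" "card e = k"
    using assms(3) by (auto simp: uniform_hypergraph_def)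
  hence "V \<noteq> {}" using assms(1) by auto
  then interpret even_uniform_hypergraph k V E
    using assms by unfold_locales auto
  let ?c = "c_max k V E"
  let ?r = "- least_H_eigenvalue k V E / (real k * real m)"
  have km: "real k * real m > 0" using assms(1,7) by simp
  have root: "root k (?c ^ k) = ?c"
    using k_pos c_max_pos by (intro real_root_power_cancel) auto
  have "?r \<le> ?c ^ k"
    unfolding pos_divide_le_eq[OF km] using neg_least_le by (simp only: assms(6) mult_ac)
  hence le: "root k ?r \<le> ?c"
    using real_root_le_mono[OF k_pos, of ?r "?c ^ k"] root by simp
  have "?c = root k ?r \<longleftrightarrow> ?c ^ k = ?r"
    using real_root_eq_iff[OF k_pos, of "?c ^ k" ?r] unfolding root .
  also have "\<dots> \<longleftrightarrow> - least = real k * (real (card E) * ?c ^ k)"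
    using km by (simp only: eq_divide_eq assms(6) mult_ac) auto
  also have "\<dots> \<longleftrightarrow> regular_hypergraph V E"
    using equality_imp_regular regular_imp_equality assms(4,5) E by blast
  finally show ?thesis using le by blast
qed

end
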